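(* Let $(R_n)_{n\ge1}$ be an ambient chain with limit $R_\infty$ as described in the context. Let $(\mathrm{cl}_n)_{n\ge1}$ be closure operations on the $R_n$ and $\mathrm{cl}_\infty$ a closure operation on $R_\infty$ forming a consistent system such that $(\mathrm{cl}_n)_n$ is compatible with $\mathrm{Sym}$. Let $\mathcal A=(A_n)_{n\ge1}$ be a $\mathrm{Sym}$-invariant, $(\mathrm{cl}_n)$-closed chain whose limit $A_\infty=\bigcup_nA_n$ is $\mathrm{cl}_\infty$-closed. Then the following are equivalent: (a) $\mathcal A$ stabilizes and is eventually finitely generated; (b) there exists $r\in\mathbb N$ such that for all $n\ge r$: (i) $A_\infty\cap R_n=A_n$, and (ii) $A_n$ is finitely generated (i.e. $A_n=G^{\mathrm{cl}_n}$ for a finite $G\subseteq A_n$) by elements of support size at most $r$; (c) $A_\infty$ is $\mathrm{Sym}$-equivariantly finitely generated, i.e. $A_\infty=(\mathrm{Sym}(\infty)(G))^{\mathrm{cl}_\infty}$ for some finite $G\subseteq A_\infty$.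
   Context: The ambient chain is one of two types. Type 1: $K$ a field, $c\ge1$, $R_n=K[x_{i,j}: i\in[c], j\in[n]]$, $R_n\subseteq R_{n+1}$, $R_\infty=K[x_{i,j}:i\in[c],j\in\mathbb N]$. Type 2: $R_n\subseteq\mathbb R^n$, where $\mathbb R^m\subseteq\mathbb R^n$ via $v\mapsto(v,0,\dots,0)$, $R_m\subseteq R_n$ for $m\le n$, $R_\infty=\bigcup_nR_n\subseteq\mathbb R^{(\mathbb N)}=\bigcup_n\mathbb R^n$, and $\pi(R_m)\subseteq R_n$ for every injective $\pi:[m]\to[n]$ (action below). For $m\le n$ let $\mathrm{Sym}_{m,n}$ be the set of injective maps $[m]\to[n]$; such $\pi$ acts $R_m\to R_n$ by $\pi(\sum_kv_k\epsilon_k)=\sum_kv_k\epsilon_{\pi(k)}$ (type 2, $\epsilon_k$ the standard basis vectors) or by the $K$-algebra homomorphism $x_{i,j}\mapsto x_{i,\pi(j)}$ (type 1). $\mathrm{Sym}(\infty)=\bigcup_n\mathrm{Sym}(n)$ (permutations of $\mathbb N$ fixing all but finitely many points) acts on $R_\infty$ in the same way. Support of $w\in R_\infty$: in type 1, the set of $j$ such that some $x_{i,j}$ occurs in $w$; in type 2, the set of $j$ with $w_j\ne0$; support size is its cardinality. A closure operation on $X$ is a map $A\mapsto A^{\mathrm{cl}}$ on subsets with $A\subseteq A^{\mathrm{cl}}$, $(A^{\mathrm{cl}})^{\mathrm{cl}}=A^{\mathrm{cl}}$, monotone; $A$ closed if $A^{\mathrm{cl}}=A$. Consistency: $(A\cap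 R_n)^{\mathrm{cl}_n}=A^{\mathrm{cl}_\infty}\cap R_n$ for all $n$ and $A\subseteq R_\infty$. Compatibility with $\mathrm{Sym}$: $\mathrm{Sym}_{m,n}(A^{\mathrm{cl}_m})\subseteq(\mathrm{Sym}_{m,n}(A))^{\mathrm{cl}_n}$ for all $n\ge m$, $A\subseteq R_m$. A chain $\mathcal A=(A_n)$ has $A_n\subseteq R_n$, $A_n\subseteq A_{n+1}$; it is $(\mathrm{cl}_n)$-closed if each $A_n$ is $\mathrm{cl}_n$-closed; $\mathrm{Sym}$-invariant if $(\mathrm{Sym}_{m,n}(A_m))^{\mathrm{cl}_n}\subseteq A_n$ for all $n\ge m$; it stabilizes if there is $r$ with $(\mathrm{Sym}_{m,n}(A_m))^{\mathrm{cl}_n}=A_n$ for all $n\ge m\ge r$; eventually finitely generated if for all large $n$, $A_n=G_n^{\mathrm{cl}_n}$ for a finite $G_n\subseteq A_n$.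
   Formalization: For type 2, (b)⇒(a),(c) is proved only if for each k all elements of R_∞ with support in [k] lie in one R_s; without this it fails (R_n={kε_i: k≤n, i≤n}, identity closures, A_n=R_n). (a)⇔(c) and (c)⇒(b) hold without it; type 1 is unchanged. *)

theory Defs
  imports "HOL-Library.Poly_Mapping" "HOL-Library.FuncSet" "HOL-Combinatorics.Permutations" Complex_Main
begin

text \<open>
  Chains are indexed by the positive integers; the value of a chain or of a system of closure
  operations at index 0 is never used.  A map acts on ring elements or vectors through an action
  \<open>act\<close>, and \<open>R\<close> is the ambient chain; both types of ambient chain are instances.
\<close>

section \<open>Chains with symmetric group actions\<close>

definition limit :: "(nat \<Rightarrow> 'a set) \<Rightarrow> 'a set" where
  "limit A = (\<Union>n\<in>{1..}. A n)"

definition Sym_maps :: "nat \<Rightarrow> nat \<Rightarrow> (nat \<Rightarrow> nat) set" where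
  "Sym_maps m n = {\<pi> \<in> {1..m} \<rightarrow>\<^sub>E {1..n}. inj_on \<pi> {1..m}}"

definition Sym_infinity :: "(nat \<Rightarrow> nat) set" where
  "Sym_infinity = (\<Union>n\<in>{1..}. {\<sigma>. \<sigma> permutes {1..n}})"

definition orbit_set :: "((nat \<Rightarrow> nat) \<Rightarrow> 'a \<Rightarrow> 'a) \<Rightarrow> (nat \<Rightarrow> nat) set \<Rightarrow> 'a set \<Rightarrow> 'a set" where
  "orbit_set act P A = {act \<pi> w | \<pi> w. \<pi> \<in> P \<and> w \<in> A}"

definition closure_operation :: "'a set \<Rightarrow> ('a set \<Rightarrow> 'a set) \<Rightarrow> bool" where
  "closure_operation X cl \<longleftrightarrow>
     (\<forall>A. A \<subseteq> X \<longrightarrow> A \<subseteq> cl A \<and> cl A \<subseteq> X \<and> cl (cl A) = cl A) \<and>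
     (\<forall>A B. A \<subseteq> B \<longrightarrow> B \<subseteq> X \<longrightarrow> cl A \<subseteq> cl B)"

definition consistent_system ::
    "(nat \<Rightarrow> 'a set) \<Rightarrow> (nat \<Rightarrow> 'a set \<Rightarrow> 'a set) \<Rightarrow> ('a set \<Rightarrow> 'a set) \<Rightarrow> bool" where
  "consistent_system R cl cl_inf \<longleftrightarrow>
     (\<forall>n\<ge>1. closure_operation (R n) (cl n)) \<and>
     closure_operation (limit R) cl_inf \<and>
     (\<forall>n\<ge>1. \<forall>A. A \<subseteq> limit R \<longrightarrow> cl n (A \<inter> R n) = cl_inf A \<inter> R n)"

definition compatible_with_Sym ::
    "(nat \<Rightarrow> 'a set) \<Rightarrow> ((nat \<Rightarrow> nat) \<Rightarrow> 'a \<Rightarrow> 'a) \<Rightarrow> (nat \<Rightarrow> 'a set \<Rightarrow> 'a set) \<Rightarrow> bool" where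
  "compatible_with_Sym R act cl \<longleftrightarrow>
     (\<forall>m\<ge>1. \<forall>n\<ge>m. \<forall>A. A \<subseteq> R m \<longrightarrow>
        orbit_set act (Sym_maps m n) (cl m A) \<subseteq> cl n (orbit_set act (Sym_maps m n) A))"

definition chain :: "(nat \<Rightarrow> 'a set) \<Rightarrow> (nat \<Rightarrow> 'a set) \<Rightarrow> bool" where
  "chain R A \<longleftrightarrow> (\<forall>n\<ge>1. A n \<subseteq> R n \<and> A n \<subseteq> A (n + 1))"

definition closed_chain :: "(nat \<Rightarrow> 'a set \<Rightarrow> 'a set) \<Rightarrow> (nat \<Rightarrow> 'a set) \<Rightarrow> bool" where
  "closed_chain cl A \<longleftrightarrow> (\<forall>n\<ge>1. cl n (A n) = A n)"

definition Sym_invariant ::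
    "((nat \<Rightarrow> nat) \<Rightarrow> 'a \<Rightarrow> 'a) \<Rightarrow> (nat \<Rightarrow> 'a set \<Rightarrow> 'a set) \<Rightarrow> (nat \<Rightarrow> 'a set) \<Rightarrow> bool" where
  "Sym_invariant act cl A \<longleftrightarrow>
     (\<forall>m\<ge>1. \<forall>n\<ge>m. cl n (orbit_set act (Sym_maps m n) (A m)) \<subseteq> A n)"

definition stabilizes ::
    "((nat \<Rightarrow> nat) \<Rightarrow> 'a \<Rightarrow> 'a) \<Rightarrow> (nat \<Rightarrow> 'a set \<Rightarrow> 'a set) \<Rightarrow> (nat \<Rightarrow> 'a set) \<Rightarrow> bool" where
  "stabilizes act cl A \<longleftrightarrow>
     (\<exists>r\<ge>1. \<forall>m\<ge>r. \<forall>n\<ge>m. cl n (orbit_set act (Sym_maps m n) (A m)) = A n)"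

definition eventually_fin_gen :: "(nat \<Rightarrow> 'a set \<Rightarrow> 'a set) \<Rightarrow> (nat \<Rightarrow> 'a set) \<Rightarrow> bool" where
  "eventually_fin_gen cl A \<longleftrightarrow>
     (\<exists>N\<ge>1. \<forall>n\<ge>N. \<exists>G. finite G \<and> G \<subseteq> A n \<and> A n = cl n G)"

definition locally_saturated_bounded_gen ::
    "(nat \<Rightarrow> 'a set) \<Rightarrow> ('a \<Rightarrow> nat set) \<Rightarrow> (nat \<Rightarrow> 'a set \<Rightarrow> 'a set) \<Rightarrow> (nat \<Rightarrow> 'a set) \<Rightarrow> bool" where
  "locally_saturated_bounded_gen R supp cl A \<longleftrightarrow>
     (\<exists>r\<ge>1. \<forall>n\<ge>r. limit A \<inter> R n = A n \<and>
        (\<exists>G. finite G \<and> G \<subseteq> A n \<and> (\<forall>g\<in>G. card (supp g) \<le> r) \<and> A n = cl n G))"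

definition Sym_equivariantly_fin_gen ::
    "((nat \<Rightarrow> nat) \<Rightarrow> 'a \<Rightarrow> 'a) \<Rightarrow> ('a set \<Rightarrow> 'a set) \<Rightarrow> 'a set \<Rightarrow> bool" where
  "Sym_equivariantly_fin_gen act cl_inf B \<longleftrightarrow>
     (\<exists>G. finite G \<and> G \<subseteq> B \<and> B = cl_inf (orbit_set act Sym_infinity G))"


section \<open>Ambient chains of polynomial rings\<close>

text \<open>
  \<open>(nat \<times> nat) \<Rightarrow>\<^sub>0 nat\<close> is the type of monomials in the \<open>x\<^bsub>i,j\<^esub>\<close>; on the type below,
  multiplication from the library is convolution, i.e. multiplication of polynomials.
\<close>

type_synonym 'k polynomial = "((nat \<times> nat) \<Rightarrow>\<^sub>0 nat) \<Rightarrow>\<^sub>0 'k"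

definition Const :: "'k::field \<Rightarrow> 'k polynomial" where
  "Const a = Poly_Mapping.single 0 a"

definition Var :: "nat \<times> nat \<Rightarrow> 'k::field polynomial" where
  "Var v = Poly_Mapping.single (Poly_Mapping.single v 1) 1"

definition vars :: "'k::field polynomial \<Rightarrow> (nat \<times> nat) set" where
  "vars p = (\<Union>t\<in>Poly_Mapping.keys p. Poly_Mapping.keys t)"

text \<open>The \<open>K\<close>-algebra homomorphism that sends each variable \<open>v\<close> to \<open>f v\<close>.\<close>

definition subst ::
    "(nat \<times> nat \<Rightarrow> 'k::field polynomial) \<Rightarrow> 'k polynomial \<Rightarrow> 'k polynomial" where
  "subst f p = (\<Sum>t\<in>Poly_Mapping.keys p. Const (Poly_Mapping.lookup p t) *
     (\<Prod>v\<in>Poly_Mapping.keys t. f v ^ Poly_Mapping.lookup t v))"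

definition poly_act :: "(nat \<Rightarrow> nat) \<Rightarrow> 'k::field polynomial \<Rightarrow> 'k polynomial" where
  "poly_act \<pi> = subst (\<lambda>(i, j). Var (i, \<pi> j))"

definition poly_supp :: "'k::field polynomial \<Rightarrow> nat set" where
  "poly_supp p = {j. \<exists>i. (i, j) \<in> vars p}"

definition poly_chain :: "nat \<Rightarrow> nat \<Rightarrow> 'k::field polynomial set" where
  "poly_chain c n = {p. vars p \<subseteq> {1..c} \<times> {1..n}}"

lemma limit_poly_chain:
  "limit (poly_chain c) = {p :: 'k::field polynomial. vars p \<subseteq> {1..c} \<times> {1..}}"
proof (intro set_eqI iffI)
  fix p :: "'k polynomial"
  assume "p \<in> limit (poly_chain c)"
  then show "p \<in> {p. vars p \<subseteq> {1..c} \<times> {1..}}"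
    by (auto simp: limit_def poly_chain_def)
next
  fix p :: "'k polynomial"
  assume p: "p \<in> {p. vars p \<subseteq> {1..c} \<times> {1..}}"
  have "finite (snd ` vars p)" by (simp add: vars_def)
  then obtain n where n: "\<forall>j\<in>snd ` vars p. j \<le> n"
    unfolding finite_nat_set_iff_bounded_le by blast
  have "vars p \<subseteq> {1..c} \<times> {1..Suc n}"
  proof
    fix v assume v: "v \<in> vars p"
    then have "v \<in> {1..c} \<times> {1..}" "snd v \<le> n" using p n by auto
    then show "v \<in> {1..c} \<times> {1..Suc n}" by (auto simp: mem_Times_iff)
  qed
  then show "p \<in> limit (poly_chain c)"
    by (auto simp: limit_def poly_chain_def intro!: bexI[of _ "Suc n"])
qed


section \<open>Ambient chains of sets of real vectors\<close>

text \<open>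
  A vector of \<open>\<real>\<^sup>n\<close> is a finitely supported family with support in \<open>{1..n}\<close>, so that the embeddings
  \<open>v \<mapsto> (v, 0, \<dots>, 0)\<close> are inclusions.
\<close>

definition vec_act :: "(nat \<Rightarrow> nat) \<Rightarrow> (nat \<Rightarrow>\<^sub>0 real) \<Rightarrow> (nat \<Rightarrow>\<^sub>0 real)" where
  "vec_act \<pi> v = (\<Sum>k\<in>Poly_Mapping.keys v. Poly_Mapping.single (\<pi> k) (Poly_Mapping.lookup v k))"

abbreviation vec_supp :: "(nat \<Rightarrow>\<^sub>0 real) \<Rightarrow> nat set" where
  "vec_supp \<equiv> Poly_Mapping.keys"

definition real_ambient_chain :: "(nat \<Rightarrow> (nat \<Rightarrow>\<^sub>0 real) set) \<Rightarrow> bool" where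
  "real_ambient_chain R \<longleftrightarrow>
     (\<forall>n\<ge>1. R n \<subseteq> {v. vec_supp v \<subseteq> {1..n}}) \<and>
     (\<forall>m\<ge>1. \<forall>n\<ge>m. R m \<subseteq> R n \<and> (\<forall>\<pi>\<in>Sym_maps m n. vec_act \<pi> ` R m \<subseteq> R n))"

text \<open>
  The elements of the limit with support in \<open>{1..k}\<close> all appear at some common stage.  This holds
  with \<open>s = k\<close> whenever \<open>R k\<close> is the intersection of \<open>limit R\<close> with \<open>\<real>\<^sup>k\<close>, as for
  \<open>R n = \<real>\<^sup>n\<close>, its nonnegative orthant, or the lattice \<open>\<int>\<^sup>n\<close> (polynomial rings have the
  analogous property).  The axioms of \<open>real_ambient_chain\<close> do not imply it, and without it local
  bounded generation does not imply equivariant finite generation: see the counterexample below.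
\<close>

definition support_exhausted :: "(nat \<Rightarrow> (nat \<Rightarrow>\<^sub>0 real) set) \<Rightarrow> bool" where
  "support_exhausted R \<longleftrightarrow>
     (\<forall>k\<ge>1. \<exists>s\<ge>1. {v \<in> limit R. vec_supp v \<subseteq> {1..k}} \<subseteq> R s)"

lemma vec_act_single:
  "vec_act \<pi> (Poly_Mapping.single i a) = Poly_Mapping.single (\<pi> i) a"
  by (cases "a = 0") (auto simp: vec_act_def)

text \<open>
  The chain of all \<open>k \<epsilon>\<^sub>i\<close> with \<open>k \<le> n\<close> and \<open>1 \<le> i \<le> n\<close>, with the identity as closure.
\<close>

lemma real_ambient_chain_counterexample:
  defines "R \<equiv> \<lambda>n. {Poly_Mapping.single i (real k) | i k. i \<in> {1..n} \<and> k \<le> n}"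
  shows "real_ambient_chain R" and "consistent_system R (\<lambda>_ A. A) (\<lambda>A. A)"
    and "compatible_with_Sym R vec_act (\<lambda>_ A. A)"
    and "chain R R" and "closed_chain (\<lambda>_ A. A) R" and "Sym_invariant vec_act (\<lambda>_ A. A) R"
    and "locally_saturated_bounded_gen R vec_supp (\<lambda>_ A. A) R"
    and "\<not> Sym_equivariantly_fin_gen vec_act (\<lambda>A. A) (limit R)"
proof -
  have mono: "R m \<subseteq> R n" if "m \<le> n" for m n
    unfolding R_def
  proof
    fix v :: "nat \<Rightarrow>\<^sub>0 real"
    assume "v \<in> {Poly_Mapping.single i (real k) | i k. i \<in> {1..m} \<and> k \<le> m}"
    then obtain i k where "v = Poly_Mapping.single i (real k)" "i \<in> {1..m}" "k \<le> m" by blast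
    moreover have "i \<in> {1..n}" "k \<le> n" using calculation that by auto
    ultimately show "v \<in> {Poly_Mapping.single i (real k) | i k. i \<in> {1..n} \<and> k \<le> n}" by blast
  qed
  have act: "vec_act \<pi> v \<in> R n" if asm: "\<pi> \<in> Sym_maps m n" "v \<in> R m" "m \<le> n" for \<pi> v m n
  proof -
    obtain i k where v: "v = Poly_Mapping.single i (real k)" "i \<in> {1..m}" "k \<le> m"
      using asm(2) unfolding R_def by blast
    moreover have "\<pi> i \<in> {1..n}" using asm(1) v(2) by (auto simp: Sym_maps_def PiE_iff)
    ultimately show ?thesis using asm(3) unfolding R_def vec_act_single v(1)
      by (intro CollectI exI[of _ "\<pi> i"] exI[of _ k]) simp
  qed
  have fin: "finite (R n)" for n
  proof -
    have "R n = (\<lambda>(i, k). Poly_Mapping.single i (real k)) ` ({1..n} \<times> {..n})"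
      unfolding R_def by (rule set_eqI) (simp add: image_iff Bex_def, blast)
    then show ?thesis by simp
  qed
  have sub: "R n \<subseteq> limit R" if "n \<ge> 1" for n
    using that by (auto simp: limit_def)
  show "real_ambient_chain R"
    using mono act by (auto simp: real_ambient_chain_def image_subset_iff)
      (auto simp: R_def split: if_splits)
  show "consistent_system R (\<lambda>_ A. A) (\<lambda>A. A)"
    by (simp add: consistent_system_def closure_operation_def)
  show "compatible_with_Sym R vec_act (\<lambda>_ A. A)"
    by (simp add: compatible_with_Sym_def)
  show "chain R R" using mono by (simp add: chain_def)
  show "closed_chain (\<lambda>_ A. A) R" by (simp add: closed_chain_def)
  show "Sym_invariant vec_act (\<lambda>_ A. A) R"
    using act by (auto simp: Sym_invariant_def orbit_set_def)
  have "card (vec_supp g) \<le> 1" if "g \<in> R n" for g n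
    using that unfolding R_def by auto
  then show "locally_saturated_bounded_gen R vec_supp (\<lambda>_ A. A) R"
    unfolding locally_saturated_bounded_gen_def
    by (intro exI[of _ 1] conjI allI impI exI[of _ "R _"])
      (use fin sub in \<open>simp_all add: Int_absorb1\<close>)
  show "\<not> Sym_equivariantly_fin_gen vec_act (\<lambda>A. A) (limit R)"
  proof
    assume "Sym_equivariantly_fin_gen vec_act (\<lambda>A. A) (limit R)"
    then obtain G where G: "finite G" "G \<subseteq> limit R" "limit R = orbit_set vec_act Sym_infinity G"
      unfolding Sym_equivariantly_fin_gen_def by blast
    define h where "h v = (\<Sum>i\<in>vec_supp v. Poly_Mapping.lookup v i)" for v :: "nat \<Rightarrow>\<^sub>0 real"
    have h: "h (Poly_Mapping.single i a) = a" for i a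
      by (cases "a = 0") (auto simp: h_def)
    have "h ` limit R \<subseteq> h ` G"
    proof
      fix x assume "x \<in> h ` limit R"
      then obtain \<sigma> g where g: "g \<in> G" "x = h (vec_act \<sigma> g)"
        using G(3) by (auto simp: orbit_set_def)
      then obtain i k where "g = Poly_Mapping.single i (real k)"
        using G(2) by (auto simp: limit_def R_def)
      then show "x \<in> h ` G" using g by (auto simp: vec_act_single h intro!: image_eqI[of _ _ g])
    qed
    moreover have "range real \<subseteq> h ` limit R"
    proof
      fix x assume "x \<in> range real"
      then obtain k where "x = real k" by blast
      moreover have "Poly_Mapping.single 1 (real k) \<in> R (Suc k)"
        unfolding R_def by (intro CollectI exI[of _ 1] exI[of _ k]) simp
      ultimately show "x \<in> h ` limit R"
        using sub[of "Suc k"] h by (metis image_eqI le_add1 plus_1_eq_Suc subsetD)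
    qed
    ultimately have "finite (range real)" using G(1) by (meson finite_imageI finite_subset)
    then show False using inj_of_nat by (metis finite_imageD infinite_UNIV_nat)
  qed
qed

end

theory Submission
  imports Defs
begin

text \<open>
  Everything rests on one extension principle: an injection between finite subsets of \<open>{1..n}\<close>
  extends to a permutation of \<open>{1..n}\<close>.  Since the action of \<open>\<pi>\<close> on \<open>w\<close> only depends on \<open>\<pi>\<close> on the
  support of \<open>w\<close>, orbits under injections and orbits under \<open>Sym(\<infinity>)\<close> agree as soon as they lie in
  \<open>R n\<close>, and elements of support size at most \<open>r\<close> can be moved to have support in \<open>{1..r}\<close>.  Both
  actions are push-forwards of finitely supported functions, the one on polynomials being iterated
  twice (variables to monomials to polynomials).
\<close>

section \<open>Push-forward of finitely supported functions\<close>

text \<open>A sum of \<open>single\<close>s adds up the values over each fibre of \<open>f\<close>,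
  so \<open>f\<close> need not be injective and functoriality holds for all maps.\<close>

definition push :: "('a \<Rightarrow> 'b) \<Rightarrow> ('a \<Rightarrow>\<^sub>0 'c::comm_monoid_add) \<Rightarrow> ('b \<Rightarrow>\<^sub>0 'c)" where
  "push f p = (\<Sum>k\<in>Poly_Mapping.keys p. Poly_Mapping.single (f k) (Poly_Mapping.lookup p k))"

text \<open>Indices outside the keys contribute \<open>single _ 0 = 0\<close>. This brings the sums
  for \<open>p\<close>, \<open>q\<close> and \<open>p + q\<close> to a common index set.\<close>

lemma push_superset:
  assumes "finite S" "Poly_Mapping.keys p \<subseteq> S"
  shows "push f p = (\<Sum>k\<in>S. Poly_Mapping.single (f k) (Poly_Mapping.lookup p k))"
  unfolding push_def using assms by (intro sum.mono_neutral_left) (auto simp: in_keys_iff)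

lemma push_zero [simp]: "push f 0 = 0"
  by (simp add: push_def)

lemma push_single [simp]: "push f (Poly_Mapping.single k a) = Poly_Mapping.single (f k) a"
  by (cases "a = 0") (auto simp: push_def)

lemma push_add: "push f (p + q) = push f p + push f q"
proof -
  let ?S = "Poly_Mapping.keys p \<union> Poly_Mapping.keys q"
  have "Poly_Mapping.keys (p + q) \<subseteq> ?S" by (rule keys_add)
  then show ?thesis
    by (simp add: push_superset[of ?S] lookup_add single_add sum.distrib)
qed

lemma push_sum: "push f (sum g S) = (\<Sum>i\<in>S. push f (g i))"
  by (induction S rule: infinite_finite_induct) (simp_all add: push_add)

lemma push_push: "push f (push g p) = push (f \<circ> g) p"
  by (simp add: push_def[of g] push_def[of "f \<circ> g"] push_sum)

lemma push_id: "push id p = p"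
  by (rule poly_mapping_eqI)
    (simp add: push_def lookup_sum lookup_single when_def in_keys_iff)

lemma push_cong:
  "(\<And>k. k \<in> Poly_Mapping.keys p \<Longrightarrow> f k = g k) \<Longrightarrow> push f p = push g p"
  by (simp add: push_def)

lemma keys_push: "Poly_Mapping.keys (push f p) \<subseteq> f ` Poly_Mapping.keys p"
proof -
  have "Poly_Mapping.keys (push f p) \<subseteq>
      (\<Union>k\<in>Poly_Mapping.keys p. Poly_Mapping.keys (Poly_Mapping.single (f k) (Poly_Mapping.lookup p k)))"
    unfolding push_def by (rule keys_sum)
  also have "\<dots> \<subseteq> f ` Poly_Mapping.keys p" by auto
  finally show ?thesis .
qed


section \<open>Extending injections\<close>

lemma inj_on_extends_to_permutation:
  assumes "finite X" "S \<subseteq> X" "inj_on f S" "f ` S \<subseteq> X"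
  shows "\<exists>\<sigma>. \<sigma> permutes X \<and> (\<forall>x\<in>S. \<sigma> x = f x)"
proof -
  have fin: "finite S" using assms finite_subset by blast
  have "card (X - S) = card (X - f ` S)"
    using assms fin by (simp add: card_Diff_subset card_image)
  then obtain h where h: "bij_betw h (X - S) (X - f ` S)"
    using assms(1) by (meson finite_Diff finite_same_card_bij)
  define \<sigma> where "\<sigma> x = (if x \<in> S then f x else if x \<in> X then h x else x)" for x
  have "bij_betw \<sigma> S (f ` S)"
    using assms(3) by (simp add: \<sigma>_def bij_betw_def inj_on_def image_def)
  moreover have "bij_betw \<sigma> (X - S) (X - f ` S)"
    using h by (subst bij_betw_cong[of _ _ h]) (auto simp: \<sigma>_def)
  ultimately have "bij_betw \<sigma> (S \<union> (X - S)) (f ` S \<union> (X - f ` S))"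
    by (rule bij_betw_combine) auto
  then have "bij_betw \<sigma> X X" using assms by (simp add: Un_absorb1)
  then have "\<sigma> permutes X"
    by (rule bij_imp_permutes) (use assms(2) in \<open>auto simp: \<sigma>_def\<close>)
  then show ?thesis by (intro exI[of _ \<sigma>]) (simp add: \<sigma>_def)
qed

lemma inj_on_extends_to_Sym_maps:
  assumes "m \<le> n" "S \<subseteq> {1..m}" "inj_on f S" "f ` S \<subseteq> {1..n}"
  shows "\<exists>\<pi>\<in>Sym_maps m n. \<forall>x\<in>S. \<pi> x = f x"
proof -
  have S: "S \<subseteq> {1..n}" using assms(1,2) by fastforce
  obtain \<sigma> where \<sigma>: "\<sigma> permutes {1..n}" "\<forall>x\<in>S. \<sigma> x = f x"
    using inj_on_extends_to_permutation[OF finite_atLeastAtMost S assms(3,4)] by blast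
  \<comment> \<open>\<open>Sym_maps\<close> consists of extensional functions, hence the
    restriction.\<close>
  have "restrict \<sigma> {1..m} \<in> Sym_maps m n"
    using permutes_in_image[OF \<sigma>(1)] permutes_inj_on[OF \<sigma>(1)] assms(1)
    by (auto simp: Sym_maps_def inj_on_restrict_eq)
  then show ?thesis by (rule bexI[rotated]) (use assms(2) \<sigma>(2) in auto)
qed

lemma finite_Sym_maps: "finite (Sym_maps m n)"
  unfolding Sym_maps_def by (rule finite_subset[OF _ finite_PiE[of "{1..m}" "\<lambda>_. {1..n}"]]) auto

lemma orbit_set_mono: "A \<subseteq> B \<Longrightarrow> orbit_set act P A \<subseteq> orbit_set act P B"
  by (auto simp: orbit_set_def)

lemma finite_orbit_set:
  assumes "finite P" "finite G"
  shows "finite (orbit_set act P G)"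
proof -
  have "orbit_set act P G = (\<lambda>(\<pi>, w). act \<pi> w) ` (P \<times> G)"
    by (auto simp: orbit_set_def)
  then show ?thesis using assms by simp
qed


section \<open>Closed chains in an ambient chain\<close>

text \<open>What the two types of ambient chain share. \<open>act_cong\<close> makes the values of
  an injection outside \<open>{1..m}\<close> harmless. \<open>supp_act\<close> is only an inclusion
  because terms can cancel under a map that is not injective.\<close>

locale sym_ambient =
  fixes R :: "nat \<Rightarrow> 'a set" and act :: "(nat \<Rightarrow> nat) \<Rightarrow> 'a \<Rightarrow> 'a" and supp :: "'a \<Rightarrow> nat set"
  assumes R_mono: "1 \<le> m \<Longrightarrow> m \<le> n \<Longrightarrow> R m \<subseteq> R n"
    and act_mem: "1 \<le> m \<Longrightarrow> m \<le> n \<Longrightarrow> \<pi> \<in> Sym_maps m n \<Longrightarrow> w \<in> R m \<Longrightarrow> act \<pi> w \<in> R n"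
    and supp_R: "1 \<le> n \<Longrightarrow> w \<in> R n \<Longrightarrow> supp w \<subseteq> {1..n}"
    and act_cong: "(\<And>j. j \<in> supp w \<Longrightarrow> \<pi> j = \<rho> j) \<Longrightarrow> act \<pi> w = act \<rho> w"
    and act_act: "act \<pi> (act \<rho> w) = act (\<pi> \<circ> \<rho>) w"
    and act_id: "act id w = w"
    and supp_act: "supp (act \<pi> w) \<subseteq> \<pi> ` supp w"
begin

text \<open>The missing inclusion is \<open>supp_act\<close> for the inverse permutation.\<close>

lemma supp_act_perm:
  assumes "\<sigma> permutes X"
  shows "supp (act \<sigma> w) = \<sigma> ` supp w"
proof
  have "w = act (inv \<sigma>) (act \<sigma> w)"
    using permutes_inv_o[OF assms] by (simp add: act_act act_id)
  then have "supp w \<subseteq> inv \<sigma> ` supp (act \<sigma> w)" using supp_act by metis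
  then have "\<sigma> ` supp w \<subseteq> \<sigma> ` inv \<sigma> ` supp (act \<sigma> w)" by (rule image_mono)
  then show "\<sigma> ` supp w \<subseteq> supp (act \<sigma> w)"
    using permutes_surj[OF assms] by (simp add: image_f_inv_f)
qed (rule supp_act)

lemma orbit_Sym_maps_subset_R:
  assumes "1 \<le> m" "m \<le> n" "G \<subseteq> R m"
  shows "orbit_set act (Sym_maps m n) G \<subseteq> R n"
  using act_mem assms by (auto simp: orbit_set_def)

text \<open>A permutation of \<open>{1..k}\<close> also permutes \<open>{1..n}\<close>, and on
  \<open>supp g\<close>, which lies in \<open>{1..m}\<close>, it agrees with an injection from
  \<open>{1..m}\<close> to \<open>{1..n}\<close>.\<close>

lemma act_perm_in_orbit:
  assumes "1 \<le> m" "m \<le> n" "\<sigma> permutes {1..k}" "k \<le> n" "G \<subseteq> R m" "g \<in> G"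
  shows "act \<sigma> g \<in> orbit_set act (Sym_maps m n) G"
proof -
  have \<sigma>: "\<sigma> permutes {1..n}" using assms by (auto intro: permutes_subset)
  have S: "supp g \<subseteq> {1..m}" using assms(1,5,6) supp_R by blast
  have im: "\<sigma> ` supp g \<subseteq> {1..n}"
    using permutes_image[OF \<sigma>] S assms(2) by fastforce
  obtain \<pi> where \<pi>: "\<pi> \<in> Sym_maps m n" "\<forall>x\<in>supp g. \<pi> x = \<sigma> x"
    using inj_on_extends_to_Sym_maps[OF assms(2) S permutes_inj_on[OF \<sigma>] im] by blast
  have "act \<sigma> g = act \<pi> g" by (rule act_cong) (simp add: \<pi>)
  then show ?thesis using \<pi> assms(6) by (auto simp: orbit_set_def)
qed

lemma orbit_Sym_maps_subset_Sym_infinity: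
  assumes "1 \<le> m" "m \<le> n" "G \<subseteq> R m"
  shows "orbit_set act (Sym_maps m n) G \<subseteq> orbit_set act Sym_infinity G"
proof
  fix x assume "x \<in> orbit_set act (Sym_maps m n) G"
  then obtain \<pi> g where \<pi>: "\<pi> \<in> Sym_maps m n" "g \<in> G" "x = act \<pi> g"
    by (auto simp: orbit_set_def)
  have S: "supp g \<subseteq> {1..m}" using assms \<pi> supp_R by blast
  have \<pi>': "inj_on \<pi> {1..m}" "\<pi> ` {1..m} \<subseteq> {1..n}" "{1..m} \<subseteq> {1..n}"
    using \<pi>(1) assms(2) by (auto simp: Sym_maps_def)
  obtain \<sigma> where \<sigma>: "\<sigma> permutes {1..n}" "\<forall>x\<in>{1..m}. \<sigma> x = \<pi> x"
    using inj_on_extends_to_permutation[OF finite_atLeastAtMost \<pi>'(3,1,2)] by blast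
  have "act \<pi> g = act \<sigma> g" by (rule act_cong) (use \<sigma>(2) S in auto)
  moreover have "\<sigma> \<in> Sym_infinity" using \<sigma>(1) assms by (auto simp: Sym_infinity_def)
  ultimately show "x \<in> orbit_set act Sym_infinity G" using \<pi> by (auto simp: orbit_set_def)
qed

text \<open>A permutation may move points beyond \<open>n\<close>, but if its result lies in
  \<open>R n\<close>, then it maps \<open>supp g\<close> into \<open>{1..n}\<close>. Only this part
  of it matters, and it extends to an injection from \<open>{1..m}\<close> to
  \<open>{1..n}\<close>.\<close>

lemma orbit_Sym_infinity_Int_R:
  assumes "1 \<le> m" "m \<le> n" "G \<subseteq> R m"
  shows "orbit_set act Sym_infinity G \<inter> R n \<subseteq> orbit_set act (Sym_maps m n) G"
proof
  fix x assume x: "x \<in> orbit_set act Sym_infinity G \<inter> R n"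
  then obtain \<sigma> k g where \<sigma>: "\<sigma> permutes {1..k}" "g \<in> G" "x = act \<sigma> g"
    by (auto simp: orbit_set_def Sym_infinity_def)
  have S: "supp g \<subseteq> {1..m}" using assms \<sigma> supp_R by blast
  \<comment> \<open>Equality of supports is essential: the inclusion \<open>supp_act\<close> would
    not bound the image of \<open>supp g\<close>.\<close>
  have "\<sigma> ` supp g = supp x" using supp_act_perm[OF \<sigma>(1)] \<sigma>(3) by simp
  also have "\<dots> \<subseteq> {1..n}" using supp_R[of n x] assms x by auto
  finally have im: "\<sigma> ` supp g \<subseteq> {1..n}" .
  obtain \<pi> where \<pi>: "\<pi> \<in> Sym_maps m n" "\<forall>x\<in>supp g. \<pi> x = \<sigma> x"
    using inj_on_extends_to_Sym_maps[OF assms(2) S permutes_inj_on[OF \<sigma>(1)] im] by blast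
  have "act \<sigma> g = act \<pi> g" by (rule act_cong) (simp add: \<pi>)
  then show "x \<in> orbit_set act (Sym_maps m n) G" using \<pi> \<sigma> by (auto simp: orbit_set_def)
qed

lemma act_into_initial_segment:
  assumes "1 \<le> r" "r \<le> n" "w \<in> R n" "card (supp w) \<le> r"
  obtains \<sigma> where "\<sigma> permutes {1..n}" "supp (act \<sigma> w) \<subseteq> {1..r}"
proof -
  have S: "supp w \<subseteq> {1..n}" using assms supp_R[of n] by auto
  then have "finite (supp w)" by (rule finite_subset) simp
  then obtain f where f: "bij_betw f (supp w) {1..card (supp w)}"
    by (metis bij_betw_iff_card card_atLeastAtMost diff_Suc_1 finite_atLeastAtMost)
  have "{1..card (supp w)} \<subseteq> {1..r}" "{1..r} \<subseteq> {1..n}" using assms by auto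
  moreover have "inj_on f (supp w)" "f ` supp w = {1..card (supp w)}"
    using f by (auto simp: bij_betw_def)
  \<comment> \<open>The bound by \<open>n\<close> allows the extension to a permutation of
    \<open>{1..n}\<close>; the bound by \<open>r\<close> is the claim.\<close>
  ultimately have f': "inj_on f (supp w)" "f ` supp w \<subseteq> {1..r}" "f ` supp w \<subseteq> {1..n}" by auto
  obtain \<sigma> where \<sigma>: "\<sigma> permutes {1..n}" "\<forall>x\<in>supp w. \<sigma> x = f x"
    using inj_on_extends_to_permutation[OF finite_atLeastAtMost S f'(1,3)] by blast
  have "supp (act \<sigma> w) \<subseteq> {1..r}"
    using supp_act_perm[OF \<sigma>(1)] \<sigma>(2) f'(2) by auto
  with \<sigma>(1) show thesis by (rule that)
qed

end

locale sym_closed_chain = sym_ambient R act supp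
  for R :: "nat \<Rightarrow> 'a set" and act supp +
  fixes cl :: "nat \<Rightarrow> 'a set \<Rightarrow> 'a set" and cl_inf :: "'a set \<Rightarrow> 'a set" and A :: "nat \<Rightarrow> 'a set"
  assumes consistent: "consistent_system R cl cl_inf"
    and compatible: "compatible_with_Sym R act cl"
    and chain_A: "chain R A"
    and closed_A: "closed_chain cl A"
    and invariant_A: "Sym_invariant act cl A"
    and closed_limit: "cl_inf (limit A) = limit A"
begin

section \<open>Closure operations and stages of the chain\<close>

lemma closure_cl: "n \<ge> 1 \<Longrightarrow> closure_operation (R n) (cl n)"
  using consistent by (simp add: consistent_system_def)

lemma closure_cl_inf: "closure_operation (limit R) cl_inf"
  using consistent by (simp add: consistent_system_def)

lemma
  assumes "n \<ge> 1" "B \<subseteq> R n"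
  shows cl_incl: "B \<subseteq> cl n B" and cl_subset_R: "cl n B \<subseteq> R n"
    and cl_idem: "cl n (cl n B) = cl n B" and cl_mono: "C \<subseteq> B \<Longrightarrow> cl n C \<subseteq> cl n B"
  using closure_cl[OF assms(1)] assms(2) by (simp_all add: closure_operation_def)

lemma
  assumes "B \<subseteq> limit R"
  shows cl_inf_idem: "cl_inf (cl_inf B) = cl_inf B"
    and cl_inf_subset: "cl_inf B \<subseteq> limit R" and cl_inf_mono: "C \<subseteq> B \<Longrightarrow> cl_inf C \<subseteq> cl_inf B"
  using closure_cl_inf assms by (simp_all add: closure_operation_def)

lemma cl_inf_Int_R:
  "B \<subseteq> limit R \<Longrightarrow> n \<ge> 1 \<Longrightarrow> cl n (B \<inter> R n) = cl_inf B \<inter> R n"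
  using consistent by (simp add: consistent_system_def)

lemma A_subset_R: "n \<ge> 1 \<Longrightarrow> A n \<subseteq> R n"
  using chain_A by (simp add: chain_def)

lemma A_mono:
  assumes "1 \<le> m" "m \<le> n"
  shows "A m \<subseteq> A n"
  using assms(2)
proof (induction n rule: dec_induct)
  case (step k)
  then show ?case using chain_A assms(1) unfolding chain_def
    by (metis Suc_eq_plus1 le_trans order_trans)
qed simp

lemma A_subset_limit: "n \<ge> 1 \<Longrightarrow> A n \<subseteq> limit A"
  by (auto simp: limit_def)

lemma R_subset_limit: "n \<ge> 1 \<Longrightarrow> R n \<subseteq> limit R"
  by (auto simp: limit_def)

lemma limit_A_subset: "limit A \<subseteq> limit R"
  using A_subset_R by (fastforce simp: limit_def)

lemma finite_subset_limit:
  assumes "finite G" "G \<subseteq> limit A"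
  obtains r where "r \<ge> 1" "G \<subseteq> A r"
proof -
  have "\<exists>r\<ge>1. G \<subseteq> A r"
    using assms
  proof (induction G rule: finite_induct)
    case (insert g G)
    then obtain r s where "r \<ge> 1" "G \<subseteq> A r" "s \<ge> 1" "g \<in> A s"
      by (auto simp: limit_def)
    moreover have "A r \<subseteq> A (max r s)" "A s \<subseteq> A (max r s)"
      using A_mono calculation by auto
    ultimately show ?case by (intro exI[of _ "max r s"]) auto
  qed auto
  then show thesis using that by blast
qed

text \<open>Consistency applied to a set that already lies in \<open>R n\<close>.\<close>

lemma cl_subset_cl_inf:
  assumes "n \<ge> 1" "B \<subseteq> R n"
  shows "cl n B \<subseteq> cl_inf B"
proof -
  have "B \<subseteq> limit R" using assms R_subset_limit by blast
  then have "cl n (B \<inter> R n) \<subseteq> cl_inf B" using cl_inf_Int_R assms(1) by simp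
  then show ?thesis using assms by (simp add: Int_absorb2)
qed

section \<open>Orbits and their closures inside the chain\<close>

lemma orbit_A_subset:
  assumes "1 \<le> m" "m \<le> n" "G \<subseteq> A m"
  shows "orbit_set act (Sym_maps m n) G \<subseteq> A n"
proof -
  have "orbit_set act (Sym_maps m n) (A m) \<subseteq> R n"
    using orbit_Sym_maps_subset_R A_subset_R assms by simp
  then have "orbit_set act (Sym_maps m n) (A m) \<subseteq> cl n (orbit_set act (Sym_maps m n) (A m))"
    using cl_incl assms by simp
  also have "\<dots> \<subseteq> A n" using invariant_A assms by (simp add: Sym_invariant_def)
  finally show ?thesis using orbit_set_mono[OF assms(3)] by blast
qed

lemma cl_subset_A:
  assumes "1 \<le> n" "B \<subseteq> A n"
  shows "cl n B \<subseteq> A n"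
  using cl_mono[OF assms(1) A_subset_R assms(2)] closed_A assms(1) by (simp add: closed_chain_def)

text \<open>Every element of Sym(\<infinity>) permutes some \<open>{1..k}\<close>. At stage
  \<open>max m k\<close> it acts on \<open>G\<close> like an injection, so invariance of the chain
  applies.\<close>

lemma orbit_Sym_infinity_subset_limit:
  assumes "1 \<le> m" "G \<subseteq> A m"
  shows "orbit_set act Sym_infinity G \<subseteq> limit A"
proof
  fix x assume "x \<in> orbit_set act Sym_infinity G"
  then obtain \<sigma> k g where \<sigma>: "\<sigma> permutes {1..k}" "g \<in> G" "x = act \<sigma> g"
    by (auto simp: orbit_set_def Sym_infinity_def)
  have "G \<subseteq> R m" using assms A_subset_R by blast
  then have "x \<in> orbit_set act (Sym_maps m (max m k)) G"
    using act_perm_in_orbit[of m "max m k" \<sigma> k G g] assms \<sigma> by auto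
  also have "\<dots> \<subseteq> A (max m k)" using orbit_A_subset assms by simp
  also have "\<dots> \<subseteq> limit A" using A_subset_limit assms by simp
  finally show "x \<in> limit A" .
qed

lemma cl_inf_orbit_subset_limit:
  assumes "1 \<le> m" "G \<subseteq> A m"
  shows "cl_inf (orbit_set act Sym_infinity G) \<subseteq> limit A"
  using cl_inf_mono[OF limit_A_subset orbit_Sym_infinity_subset_limit[OF assms]] closed_limit
  by simp

text \<open>Compatibility moves the closure out of the orbit, and consistency compares the result
  with the closure in the limit. In the third claim, \<open>G \<subseteq> A m\<close> places the
  Sym(\<infinity>)-orbit inside \<open>limit R\<close>, where \<open>cl_inf\<close> is
  monotone.\<close>

lemma orbit_cl_subset_cl_inf:
  assumes "1 \<le> m" "m \<le> n" "G \<subseteq> R m"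
  shows "orbit_set act (Sym_maps m n) (cl m G) \<subseteq> cl n (orbit_set act (Sym_maps m n) G)"
    and "cl n (orbit_set act (Sym_maps m n) G) \<subseteq> R n"
    and "G \<subseteq> A m \<Longrightarrow>
      cl n (orbit_set act (Sym_maps m n) G) \<subseteq> cl_inf (orbit_set act Sym_infinity G)"
proof -
  let ?O = "orbit_set act (Sym_maps m n) G"
  have O: "?O \<subseteq> R n" using orbit_Sym_maps_subset_R assms by simp
  show "orbit_set act (Sym_maps m n) (cl m G) \<subseteq> cl n ?O"
    using compatible assms by (simp add: compatible_with_Sym_def)
  show "cl n ?O \<subseteq> R n" using O cl_subset_R assms by simp
  assume "G \<subseteq> A m"
  then have "orbit_set act Sym_infinity G \<subseteq> limit R"
    using orbit_Sym_infinity_subset_limit limit_A_subset assms(1) by blast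
  then have "cl_inf ?O \<subseteq> cl_inf (orbit_set act Sym_infinity G)"
    using cl_inf_mono orbit_Sym_maps_subset_Sym_infinity assms by simp
  then show "cl n ?O \<subseteq> cl_inf (orbit_set act Sym_infinity G)"
    using cl_subset_cl_inf[OF _ O] assms by auto
qed

section \<open>From (a) to (c)\<close>

lemma stabilizes_imp_Sym_equivariantly_fin_gen:
  assumes "stabilizes act cl A" "eventually_fin_gen cl A"
  shows "Sym_equivariantly_fin_gen act cl_inf (limit A)"
proof -
  obtain r where r: "r \<ge> 1"
    "\<And>m n. r \<le> m \<Longrightarrow> m \<le> n \<Longrightarrow> cl n (orbit_set act (Sym_maps m n) (A m)) = A n"
    using assms(1) unfolding stabilizes_def by blast
  obtain N where N: "\<And>n. N \<le> n \<Longrightarrow> \<exists>G. finite G \<and> G \<subseteq> A n \<and> A n = cl n G"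
    using assms(2) unfolding eventually_fin_gen_def by blast
  \<comment> \<open>One stage past both thresholds: from here on the chain is determined by
    \<open>A m\<close>, which has finitely many generators.\<close>
  define m where "m = max r N"
  have m: "m \<ge> 1" "r \<le> m" using r(1) by (auto simp: m_def)
  obtain G where G: "finite G" "G \<subseteq> A m" "A m = cl m G" using N[of m] unfolding m_def by auto
  have GR: "G \<subseteq> R m" using G A_subset_R m by blast
  have *: "A n \<subseteq> cl_inf (orbit_set act Sym_infinity G)" if "m \<le> n" for n
  proof -
    let ?O = "orbit_set act (Sym_maps m n) G"
    have O: "?O \<subseteq> R n" using orbit_Sym_maps_subset_R[OF m(1) that GR] .
    have n: "n \<ge> 1" using m(1) that by simp
    have "A n = cl n (orbit_set act (Sym_maps m n) (cl m G))" using r(2)[OF m(2) that] G(3) by simp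
    \<comment> \<open>By compatibility, orbits of the closure of \<open>G\<close> lie in the closure
      of the orbit of \<open>G\<close>.\<close>
    also have "\<dots> \<subseteq> cl n (cl n ?O)"
      by (rule cl_mono[OF n]) (use orbit_cl_subset_cl_inf[OF m(1) that GR] in auto)
    also have "\<dots> = cl n ?O" using cl_idem[OF n O] .
    also have "\<dots> \<subseteq> cl_inf (orbit_set act Sym_infinity G)"
      using orbit_cl_subset_cl_inf(3)[OF m(1) that GR G(2)] .
    finally show ?thesis .
  qed
  have "limit A \<subseteq> cl_inf (orbit_set act Sym_infinity G)"
  proof
    fix x assume "x \<in> limit A"
    then obtain n where n: "n \<ge> 1" "x \<in> A n" by (auto simp: limit_def)
    then have "x \<in> A (max m n)" using A_mono[of n "max m n"] by auto
    then show "x \<in> cl_inf (orbit_set act Sym_infinity G)" using *[of "max m n"] by auto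
  qed
  then have "limit A = cl_inf (orbit_set act Sym_infinity G)"
    using cl_inf_orbit_subset_limit[OF m(1) G(2)] by simp
  moreover have "G \<subseteq> limit A" using G(2) A_subset_limit m by blast
  ultimately show ?thesis using G(1) unfolding Sym_equivariantly_fin_gen_def by blast
qed

section \<open>From (c) to (b) and (a)\<close>

text \<open>Take \<open>r\<close> with \<open>G \<subseteq> A r\<close>. Consistency turns
  \<open>limit A \<inter> R n\<close> into the closure of the part of the Sym(\<infinity>)-orbit in
  \<open>R n\<close>, and that part is reached by injections from \<open>{1..r}\<close>.\<close>

lemma Sym_equivariantly_fin_genD:
  assumes "Sym_equivariantly_fin_gen act cl_inf (limit A)"
  shows "\<exists>r\<ge>1. \<exists>G. finite G \<and> G \<subseteq> A r \<and>
    (\<forall>n\<ge>r. A n = cl n (orbit_set act (Sym_maps r n) G) \<and> limit A \<inter> R n = A n)"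
proof -
  obtain G where G: "finite G" "G \<subseteq> limit A" "limit A = cl_inf (orbit_set act Sym_infinity G)"
    using assms unfolding Sym_equivariantly_fin_gen_def by blast
  obtain r where r: "r \<ge> 1" "G \<subseteq> A r" using finite_subset_limit[OF G(1,2)] .
  have GR: "G \<subseteq> R r" using r A_subset_R by blast
  have *: "A n = cl n (orbit_set act (Sym_maps r n) G) \<and> limit A \<inter> R n = A n" if "r \<le> n" for n
  proof -
    have n: "n \<ge> 1" using r(1) that by simp
    let ?O = "orbit_set act (Sym_maps r n) G"
    have "orbit_set act Sym_infinity G \<subseteq> limit R"
      using orbit_Sym_infinity_subset_limit[OF r] limit_A_subset by blast
    then have "limit A \<inter> R n = cl n (orbit_set act Sym_infinity G \<inter> R n)"
      using cl_inf_Int_R n G(3) by simp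
    also have "\<dots> \<subseteq> cl n ?O"
      by (rule cl_mono[OF n])
        (use orbit_Sym_maps_subset_R orbit_Sym_infinity_Int_R r that GR in auto)
    finally have "limit A \<inter> R n \<subseteq> cl n ?O" .
    \<comment> \<open>The next two inclusions close a cycle, so all three sets coincide.\<close>
    moreover have "cl n ?O \<subseteq> A n" using cl_subset_A[OF n] orbit_A_subset[OF r(1) that r(2)] by blast
    moreover have "A n \<subseteq> limit A \<inter> R n" using A_subset_limit A_subset_R n by simp
    ultimately show ?thesis by blast
  qed
  show ?thesis using r G(1) * by blast
qed

text \<open>The finite orbit of \<open>G\<close> under \<open>Sym_maps r n\<close> generates
  \<open>A n\<close>. Elements of \<open>G\<close> have support in \<open>{1..r}\<close> and the
  action cannot enlarge the support size, so \<open>r\<close> is also the required bound.\<close>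

lemma Sym_equivariantly_fin_gen_imp_bounded_gen:
  assumes "Sym_equivariantly_fin_gen act cl_inf (limit A)"
  shows "locally_saturated_bounded_gen R supp cl A"
proof -
  obtain r G where r: "r \<ge> 1" "finite G" "G \<subseteq> A r"
    "\<And>n. r \<le> n \<Longrightarrow> A n = cl n (orbit_set act (Sym_maps r n) G)"
    "\<And>n. r \<le> n \<Longrightarrow> limit A \<inter> R n = A n"
    using Sym_equivariantly_fin_genD[OF assms] by blast
  have "card (supp x) \<le> r" if x: "x \<in> orbit_set act (Sym_maps r n) G" for x n
  proof -
    obtain \<pi> g where g: "g \<in> G" "x = act \<pi> g" using x by (auto simp: orbit_set_def)
    have S: "supp g \<subseteq> {1..r}" using g r(1,3) A_subset_R supp_R by blast
    have "supp x \<subseteq> \<pi> ` {1..r}" using supp_act[of \<pi> g] S g(2) by blast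
    then have "card (supp x) \<le> card (\<pi> ` {1..r})" by (rule card_mono[rotated]) simp
    also have "\<dots> \<le> r" using card_image_le[of "{1..r}" \<pi>] by simp
    finally show ?thesis .
  qed
  moreover have "finite (orbit_set act (Sym_maps r n) G)" for n
    using finite_orbit_set finite_Sym_maps r(2) by blast
  ultimately have "\<exists>H. finite H \<and> H \<subseteq> A n \<and> (\<forall>g\<in>H. card (supp g) \<le> r) \<and> A n = cl n H"
    if "r \<le> n" for n
    using orbit_A_subset[OF r(1) that r(3)] r(4)[OF that]
    by (intro exI[of _ "orbit_set act (Sym_maps r n) G"] conjI ballI)
  then show ?thesis
    unfolding locally_saturated_bounded_gen_def using r(1,5) by (intro exI[of _ r] conjI allI impI)
qed

lemma Sym_equivariantly_fin_gen_imp_stabilizes: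
  assumes "Sym_equivariantly_fin_gen act cl_inf (limit A)"
  shows "stabilizes act cl A"
proof -
  obtain r G where r: "r \<ge> 1" "finite G" "G \<subseteq> A r"
    "\<And>n. r \<le> n \<Longrightarrow> A n = cl n (orbit_set act (Sym_maps r n) G)"
    "\<And>n. r \<le> n \<Longrightarrow> limit A \<inter> R n = A n"
    using Sym_equivariantly_fin_genD[OF assms] by blast
  have "cl n (orbit_set act (Sym_maps m n) (A m)) = A n" if mn: "r \<le> m" "m \<le> n" for m n
  proof
    have m: "m \<ge> 1" "n \<ge> 1" "r \<le> n" using r(1) mn by auto
    show "cl n (orbit_set act (Sym_maps m n) (A m)) \<subseteq> A n"
      using invariant_A m(1) mn(2) by (simp add: Sym_invariant_def)
    have G: "G \<subseteq> A m" "G \<subseteq> R m" "G \<subseteq> R r"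
      using r(1,3) A_mono[OF r(1) mn(1)] A_subset_R m by blast+
    \<comment> \<open>The detour through Sym(\<infinity>) replaces factoring injections from
      \<open>{1..r}\<close> to \<open>{1..n}\<close> through \<open>{1..m}\<close>.\<close>
    have "orbit_set act (Sym_maps r n) G \<subseteq> orbit_set act Sym_infinity G \<inter> R n"
      using orbit_Sym_maps_subset_Sym_infinity[of r n G] orbit_Sym_maps_subset_R[of r n G] r(1) m G
      by simp
    also have "\<dots> \<subseteq> orbit_set act (Sym_maps m n) G"
      using orbit_Sym_infinity_Int_R[OF m(1) mn(2) G(2)] .
    also have "\<dots> \<subseteq> orbit_set act (Sym_maps m n) (A m)" using orbit_set_mono[OF G(1)] .
    finally have "cl n (orbit_set act (Sym_maps r n) G) \<subseteq> cl n (orbit_set act (Sym_maps m n) (A m))"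
      using cl_mono[OF m(2)] orbit_Sym_maps_subset_R[OF m(1) mn(2)] A_subset_R[OF m(1)] by blast
    then show "A n \<subseteq> cl n (orbit_set act (Sym_maps m n) (A m))" using r(4)[OF m(3)] by simp
  qed
  then show ?thesis unfolding stabilizes_def using r(1) by blast
qed

section \<open>Consequences of (b)\<close>

lemma bounded_gen_imp_eventually_fin_gen:
  assumes "locally_saturated_bounded_gen R supp cl A"
  shows "eventually_fin_gen cl A"
proof -
  obtain r where r: "r \<ge> 1"
    "\<forall>n\<ge>r. \<exists>G. finite G \<and> G \<subseteq> A n \<and> (\<forall>g\<in>G. card (supp g) \<le> r) \<and> A n = cl n G"
    using assms unfolding locally_saturated_bounded_gen_def by blast
  have "\<exists>G. finite G \<and> G \<subseteq> A n \<and> A n = cl n G" if "n \<ge> r" for n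
    using r(2)[rule_format, OF that] by (elim exE conjE) (intro exI conjI)
  then show ?thesis unfolding eventually_fin_gen_def using r(1) by (intro exI[of _ r] conjI allI impI)
qed

text \<open>A generator of \<open>A n\<close> with support size at most \<open>r\<close> is moved by
  a permutation into \<open>{1..r}\<close>. The result lies in a fixed stage \<open>A s\<close>, by
  exhaustion and saturation, and hence in the closure of the finite set \<open>G\<close>; the
  inverse permutation moves it back.\<close>

lemma bounded_gen_imp_Sym_equivariantly_fin_gen:
  assumes exh: "\<And>k. k \<ge> 1 \<Longrightarrow> \<exists>s\<ge>1. {v \<in> limit R. supp v \<subseteq> {1..k}} \<subseteq> R s"
    and "locally_saturated_bounded_gen R supp cl A"
  shows "Sym_equivariantly_fin_gen act cl_inf (limit A)"
proof -
  obtain r where r: "r \<ge> 1" "\<And>n. r \<le> n \<Longrightarrow> limit A \<inter> R n = A n"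
    "\<And>n. r \<le> n \<Longrightarrow> \<exists>G. finite G \<and> G \<subseteq> A n \<and> (\<forall>g\<in>G. card (supp g) \<le> r) \<and> A n = cl n G"
    using assms(2) unfolding locally_saturated_bounded_gen_def by blast
  obtain s0 where s0: "s0 \<ge> 1" "{v \<in> limit R. supp v \<subseteq> {1..r}} \<subseteq> R s0" using exh[OF r(1)] by blast
  \<comment> \<open>At least \<open>r\<close>, for saturation and finite generation at stage
    \<open>s\<close>; at least \<open>s0\<close>, so that \<open>R s\<close> contains everything in
    the limit supported in \<open>{1..r}\<close>.\<close>
  define s where "s = max r s0"
  have s: "s \<ge> 1" "r \<le> s" "{v \<in> limit R. supp v \<subseteq> {1..r}} \<subseteq> R s"
    using s0 r(1) R_mono[of s0 s] by (auto simp: s_def)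
  obtain G where G: "finite G" "G \<subseteq> A s" "A s = cl s G" using r(3)[OF s(2)] by blast
  have GR: "G \<subseteq> R s" using G(2) A_subset_R[OF s(1)] by blast
  let ?C = "cl_inf (orbit_set act Sym_infinity G)"
  have orb: "orbit_set act Sym_infinity G \<subseteq> limit R"
    using orbit_Sym_infinity_subset_limit[OF s(1) G(2)] limit_A_subset by blast
  have An: "A n \<subseteq> ?C" if sn: "s \<le> n" for n
  proof -
    have n: "n \<ge> 1" "r \<le> n" using s sn by auto
    obtain H where H: "H \<subseteq> A n" "\<forall>g\<in>H. card (supp g) \<le> r" "A n = cl n H"
      using r(3)[OF n(2)] by (elim exE conjE) (rule that)
    have HR: "H \<subseteq> R n" using H(1) A_subset_R[OF n(1)] by blast
    have "H \<subseteq> ?C"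
    proof
      fix h assume h: "h \<in> H"
      obtain \<sigma> where \<sigma>: "\<sigma> permutes {1..n}" "supp (act \<sigma> h) \<subseteq> {1..r}"
        using act_into_initial_segment[OF r(1) n(2)] HR h H(2) by blast
      have "act \<sigma> h \<in> A n"
        using act_perm_in_orbit[OF n(1) order_refl \<sigma>(1) order_refl HR h]
          orbit_A_subset[OF n(1) order_refl H(1)] by blast
      then have "act \<sigma> h \<in> limit A" using A_subset_limit[OF n(1)] by blast
      \<comment> \<open>Exhaustion gives membership in \<open>R s\<close>; saturation improves it to
        \<open>A s\<close>.\<close>
      then have hs: "act \<sigma> h \<in> A s" using s(3) \<sigma>(2) limit_A_subset r(2)[OF s(2)] by blast
      have "h = act (inv \<sigma>) (act \<sigma> h)"
        using permutes_inv_o[OF \<sigma>(1)] by (simp add: act_act act_id)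
      also have "\<dots> \<in> orbit_set act (Sym_maps s n) (A s)"
        by (rule act_perm_in_orbit[OF s(1) sn permutes_inv[OF \<sigma>(1)] order_refl A_subset_R[OF s(1)] hs])
      also have "\<dots> \<subseteq> ?C"
        using orbit_cl_subset_cl_inf(1)[OF s(1) sn GR] orbit_cl_subset_cl_inf(3)[OF s(1) sn GR G(2)]
          G(3) by auto
      finally show "h \<in> ?C" .
    qed
    moreover have C: "?C \<subseteq> limit R" using cl_inf_subset[OF orb] .
    ultimately have "cl_inf H \<subseteq> cl_inf ?C" using cl_inf_mono by blast
    then show ?thesis using cl_subset_cl_inf[OF n(1) HR] H(3) cl_inf_idem[OF orb] by simp
  qed
  have "limit A \<subseteq> ?C"
  proof
    fix x assume "x \<in> limit A"
    then obtain n where n: "n \<ge> 1" "x \<in> A n" by (auto simp: limit_def)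
    then have "x \<in> A (max s n)" using A_mono[of n "max s n"] by auto
    then show "x \<in> ?C" using An[of "max s n"] by auto
  qed
  then have "limit A = ?C" using cl_inf_orbit_subset_limit[OF s(1) G(2)] by simp
  moreover have "G \<subseteq> limit A" using G(2) A_subset_limit s by blast
  ultimately show ?thesis using G(1) unfolding Sym_equivariantly_fin_gen_def by blast
qed

text \<open>In the backward direction, eventual finite generation is obtained by way of bounded
  generation.\<close>

theorem stabilizes_iff_Sym_equivariantly_fin_gen:
  "stabilizes act cl A \<and> eventually_fin_gen cl A \<longleftrightarrow>
    Sym_equivariantly_fin_gen act cl_inf (limit A)"
  using stabilizes_imp_Sym_equivariantly_fin_gen Sym_equivariantly_fin_gen_imp_stabilizes
    Sym_equivariantly_fin_gen_imp_bounded_gen bounded_gen_imp_eventually_fin_gen by blast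

theorem bounded_gen_iff_Sym_equivariantly_fin_gen:
  assumes "\<And>k. k \<ge> 1 \<Longrightarrow> \<exists>s\<ge>1. {v \<in> limit R. supp v \<subseteq> {1..k}} \<subseteq> R s"
  shows "locally_saturated_bounded_gen R supp cl A \<longleftrightarrow>
    Sym_equivariantly_fin_gen act cl_inf (limit A)"
  using Sym_equivariantly_fin_gen_imp_bounded_gen
    bounded_gen_imp_Sym_equivariantly_fin_gen[OF assms] by blast

end


section \<open>The two types of ambient chains\<close>

lemma Sym_maps_image: "\<pi> \<in> Sym_maps m n \<Longrightarrow> \<pi> ` {1..m} \<subseteq> {1..n}"
  by (auto simp: Sym_maps_def)

section \<open>Real vectors\<close>

lemma vec_act_eq_push: "vec_act \<pi> = push \<pi>"
  by (simp add: fun_eq_iff vec_act_def push_def)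

lemma sym_ambient_vec:
  assumes "real_ambient_chain R"
  shows "sym_ambient R vec_act vec_supp"
proof
  show "R m \<subseteq> R n" if "1 \<le> m" "m \<le> n" for m n
    using assms that by (simp add: real_ambient_chain_def)
  show "vec_act \<pi> w \<in> R n" if "1 \<le> m" "m \<le> n" "\<pi> \<in> Sym_maps m n" "w \<in> R m" for m n \<pi> w
    using assms that unfolding real_ambient_chain_def by blast
  show "vec_supp w \<subseteq> {1..n}" if "1 \<le> n" "w \<in> R n" for n w
    using assms that unfolding real_ambient_chain_def by blast
  show "vec_act \<pi> w = vec_act \<rho> w" if "\<And>j. j \<in> vec_supp w \<Longrightarrow> \<pi> j = \<rho> j" for \<pi> \<rho> w
    unfolding vec_act_eq_push using that by (rule push_cong)
qed (simp_all only: vec_act_eq_push push_push push_id keys_push)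

section \<open>Polynomial rings\<close>

lemma Var_power: "Var v ^ n = (Poly_Mapping.single (Poly_Mapping.single v n) 1 :: 'k::field polynomial)"
  by (induction n) (simp_all add: Var_def mult_single flip: single_add)

lemma prod_single_one:
  "(\<Prod>v\<in>S. Poly_Mapping.single (g v) 1) =
    (Poly_Mapping.single (\<Sum>v\<in>S. g v) 1 :: 'a::comm_monoid_add \<Rightarrow>\<^sub>0 'k::comm_semiring_1)"
  by (induction S rule: infinite_finite_induct) (simp_all add: mult_single)

text \<open>Replacing variables by variables turns the monomial \<open>t\<close> into the monomial
  \<open>push f t\<close> and keeps its coefficient; the outer \<open>push\<close> collects the
  coefficients of monomials that become equal.\<close>

lemma subst_Var: "subst (\<lambda>v. Var (f v)) p = push (push f) p"
  by (simp add: subst_def Var_power prod_single_one Const_def mult_single push_def)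

lemma poly_act_eq_push: "poly_act \<pi> = (push (push (apsnd \<pi>)) :: 'k::field polynomial \<Rightarrow> _)"
proof -
  have "(\<lambda>(i, j). Var (i, \<pi> j)) = (\<lambda>v. Var (apsnd \<pi> v) :: 'k::field polynomial)"
    by (auto simp: fun_eq_iff)
  then have "poly_act \<pi> p = push (push (apsnd \<pi>)) p" for p :: "'k polynomial"
    by (simp only: poly_act_def subst_Var)
  then show ?thesis ..
qed

lemma poly_supp_eq: "poly_supp p = snd ` vars p"
  by (force simp: poly_supp_def)

text \<open>The inclusion can be strict: if \<open>f\<close> identifies variables, monomials may
  merge and their coefficients cancel.\<close>

lemma vars_push_push: "vars (push (push f) p) \<subseteq> f ` vars p"
proof
  fix v assume "v \<in> vars (push (push f) p)"
  then obtain t where t: "t \<in> Poly_Mapping.keys (push (push f) p)" "v \<in> Poly_Mapping.keys t"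
    by (auto simp: vars_def)
  then obtain u where "u \<in> Poly_Mapping.keys p" "t = push f u"
    using subsetD[OF keys_push t(1)] by blast
  then show "v \<in> f ` vars p" using t(2) keys_push[of f u] unfolding vars_def by blast
qed

lemma push_push_cong:
  assumes "\<And>v. v \<in> vars p \<Longrightarrow> f v = g v"
  shows "push (push f) p = push (push g) p"
  by (intro push_cong) (use assms in \<open>auto simp: vars_def\<close>)

lemma sym_ambient_poly:
  "sym_ambient (poly_chain c) (poly_act :: _ \<Rightarrow> 'k::field polynomial \<Rightarrow> _) poly_supp"
proof
  fix m n :: nat and \<pi> \<rho> and w :: "'k polynomial"
  show "m \<le> n \<Longrightarrow> poly_chain c m \<subseteq> (poly_chain c n :: 'k polynomial set)"
    by (fastforce simp: poly_chain_def)
  show "poly_act \<pi> w \<in> poly_chain c n" if "\<pi> \<in> Sym_maps m n" "w \<in> poly_chain c m"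
  proof -
    have "vars (poly_act \<pi> w) \<subseteq> apsnd \<pi> ` vars w"
      by (simp add: poly_act_eq_push vars_push_push)
    also have "\<dots> \<subseteq> apsnd \<pi> ` ({1..c} \<times> {1..m})"
      using that(2) by (intro image_mono) (simp add: poly_chain_def)
    also have "\<dots> \<subseteq> {1..c} \<times> {1..n}" using Sym_maps_image[OF that(1)] by auto
    finally show ?thesis by (simp add: poly_chain_def)
  qed
  show "w \<in> poly_chain c n \<Longrightarrow> poly_supp w \<subseteq> {1..n}"
    by (auto simp: poly_supp_def poly_chain_def)
  show "poly_act \<pi> w = poly_act \<rho> w" if "\<And>j. j \<in> poly_supp w \<Longrightarrow> \<pi> j = \<rho> j"
    unfolding poly_act_eq_push
  proof (rule push_push_cong)
    fix v assume "v \<in> vars w"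
    then have "snd v \<in> poly_supp w" by (simp add: poly_supp_eq)
    then show "apsnd \<pi> v = apsnd \<rho> v" using that by (simp add: prod_eq_iff)
  qed
  \<comment> \<open>Functoriality is needed twice, first on monomials and then on
    polynomials.\<close>
  have "push f \<circ> push g = (push (f \<circ> g) :: (nat \<times> nat \<Rightarrow>\<^sub>0 nat) \<Rightarrow> _)"
    for f g :: "nat \<times> nat \<Rightarrow> nat \<times> nat"
    by (simp add: fun_eq_iff push_push)
  moreover have "apsnd \<pi> \<circ> apsnd \<rho> = (apsnd (\<pi> \<circ> \<rho>) :: nat \<times> nat \<Rightarrow> _)"
    by (simp add: fun_eq_iff)
  ultimately show "poly_act \<pi> (poly_act \<rho> w) = poly_act (\<pi> \<circ> \<rho>) w"
    by (simp add: poly_act_eq_push push_push)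
  have "push (apsnd id) = (id :: (nat \<times> nat \<Rightarrow>\<^sub>0 nat) \<Rightarrow> _)"
  proof -
    have "apsnd id = (id :: nat \<times> nat \<Rightarrow> _)" by (simp add: fun_eq_iff)
    then show ?thesis by (simp add: fun_eq_iff push_id)
  qed
  then show "poly_act id w = w" by (simp add: poly_act_eq_push push_id)
  show "poly_supp (poly_act \<pi> w) \<subseteq> \<pi> ` poly_supp w"
    using vars_push_push[of "apsnd \<pi>" w] by (force simp: poly_act_eq_push poly_supp_eq)
qed

text \<open>Membership in the limit bounds the first index of each variable by \<open>c\<close>, and
  the support bounds the second by \<open>k\<close>; so exhaustion holds with
  \<open>s = k\<close>.\<close>

lemma poly_chain_support_exhausted:
  "{v \<in> limit (poly_chain c). poly_supp v \<subseteq> {1..k}} \<subseteq> poly_chain c k"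
  by (fastforce simp: limit_poly_chain poly_chain_def poly_supp_def)

text \<open>For real vectors the step from (b) to (c) is claimed under
  \<open>support_exhausted\<close>, since it fails for the chain in
  \<open>real_ambient_chain_counterexample\<close>; the equivalence of (a) and (c) and the step from
  (c) to (b) hold for every ambient chain.\<close>

theorem theorem4p10:
  shows
   "(\<forall>(c :: nat) (cl :: nat \<Rightarrow> 'k::field polynomial set \<Rightarrow> 'k polynomial set) cl_inf A.
       c \<ge> 1 \<longrightarrow>
       consistent_system (poly_chain c) cl cl_inf \<longrightarrow>
       compatible_with_Sym (poly_chain c) poly_act cl \<longrightarrow>
       chain (poly_chain c) A \<longrightarrow>
       closed_chain cl A \<longrightarrow>
       Sym_invariant poly_act cl A \<longrightarrow>
       cl_inf (limit A) = limit A \<longrightarrow>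
       ((stabilizes poly_act cl A \<and> eventually_fin_gen cl A) \<longleftrightarrow>
          locally_saturated_bounded_gen (poly_chain c) poly_supp cl A) \<and>
       (locally_saturated_bounded_gen (poly_chain c) poly_supp cl A \<longleftrightarrow>
          Sym_equivariantly_fin_gen poly_act cl_inf (limit A)))
    \<and>
    (\<forall>R cl cl_inf A.
       real_ambient_chain R \<longrightarrow>
       consistent_system R cl cl_inf \<longrightarrow>
       compatible_with_Sym R vec_act cl \<longrightarrow>
       chain R A \<longrightarrow>
       closed_chain cl A \<longrightarrow>
       Sym_invariant vec_act cl A \<longrightarrow>
       cl_inf (limit A) = limit A \<longrightarrow>
       ((stabilizes vec_act cl A \<and> eventually_fin_gen cl A) \<longleftrightarrow>
          Sym_equivariantly_fin_gen vec_act cl_inf (limit A)) \<and>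
       (Sym_equivariantly_fin_gen vec_act cl_inf (limit A) \<longrightarrow>
          locally_saturated_bounded_gen R vec_supp cl A) \<and>
       (support_exhausted R \<longrightarrow>
         ((stabilizes vec_act cl A \<and> eventually_fin_gen cl A) \<longleftrightarrow>
            locally_saturated_bounded_gen R vec_supp cl A) \<and>
         (locally_saturated_bounded_gen R vec_supp cl A \<longleftrightarrow>
            Sym_equivariantly_fin_gen vec_act cl_inf (limit A))))"
proof (intro conjI allI impI)
  fix c :: nat and cl :: "nat \<Rightarrow> 'k polynomial set \<Rightarrow> 'k polynomial set" and cl_inf A
  assume "consistent_system (poly_chain c) cl cl_inf" "compatible_with_Sym (poly_chain c) poly_act cl"
    "chain (poly_chain c) A" "closed_chain cl A" "Sym_invariant poly_act cl A"
    "cl_inf (limit A) = limit A"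
  then interpret sym_closed_chain "poly_chain c" poly_act poly_supp cl cl_inf A
    by (intro sym_closed_chain.intro sym_ambient_poly sym_closed_chain_axioms.intro)
  show bc: "locally_saturated_bounded_gen (poly_chain c) poly_supp cl A \<longleftrightarrow>
      Sym_equivariantly_fin_gen poly_act cl_inf (limit A)"
    by (rule bounded_gen_iff_Sym_equivariantly_fin_gen) (use poly_chain_support_exhausted in blast)
  show "stabilizes poly_act cl A \<and> eventually_fin_gen cl A \<longleftrightarrow>
      locally_saturated_bounded_gen (poly_chain c) poly_supp cl A"
    unfolding bc by (rule stabilizes_iff_Sym_equivariantly_fin_gen)
next
  fix R cl cl_inf A
  assume "real_ambient_chain R"
    and *: "consistent_system R cl cl_inf" "compatible_with_Sym R vec_act cl" "chain R A"
      "closed_chain cl A" "Sym_invariant vec_act cl A" "cl_inf (limit A) = limit A"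
  then interpret sym_closed_chain R vec_act vec_supp cl cl_inf A
    by (intro sym_closed_chain.intro sym_ambient_vec sym_closed_chain_axioms.intro)
  show ac: "stabilizes vec_act cl A \<and> eventually_fin_gen cl A \<longleftrightarrow>
      Sym_equivariantly_fin_gen vec_act cl_inf (limit A)"
    by (rule stabilizes_iff_Sym_equivariantly_fin_gen)
  show "Sym_equivariantly_fin_gen vec_act cl_inf (limit A) \<Longrightarrow>
      locally_saturated_bounded_gen R vec_supp cl A"
    by (rule Sym_equivariantly_fin_gen_imp_bounded_gen)
  assume "support_exhausted R"
  then show bc: "locally_saturated_bounded_gen R vec_supp cl A \<longleftrightarrow>
      Sym_equivariantly_fin_gen vec_act cl_inf (limit A)"
    by (intro bounded_gen_iff_Sym_equivariantly_fin_gen) (simp add: support_exhausted_def)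
  show "stabilizes vec_act cl A \<and> eventually_fin_gen cl A \<longleftrightarrow>
      locally_saturated_bounded_gen R vec_supp cl A"
    unfolding ac bc ..
qed

end
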